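(* Let $j\ge 1$ and let $a,b$ be integers with $g=\gcd(a,b)>1$; write $a=a_1g$, $b=b_1g$. Then there is a finite set $R$ of positive integers such that $$R^{(j)}_{a,b}=\{\,n=Gn_1:\ G\in\mathcal F_g,\ n_1\in R^{(j)}_{a_1^G,\,b_1^G},\ \gcd(g,n_1)=1\,\}\setminus R .$$ Moreover, every element $n=Gn_1$ of $R$ (with $G\in\mathcal F_g$ and $\gcd(n_1,g)=1$) satisfies $1\le n_1<j/2$ and $G=q_1^{\ell_1}\cdots q_m^{\ell_m}$ with $\sum_{i=1}^m \ell_i<K^{(j)}_{g^{n_1}}$, where $q_1,\dots,q_m$ are the distinct primes dividing $g$ and $\ell_i\ge 0$.
   Context: For integers $a,b$ and $j\ge 1$, $R^{(j)}_{a,b}=\{n\in\mathbb N: n^j\mid a^n-b^n\}$. For an integer $c>1$, $\mathcal F_c$ is the set of all positive integers all of whose prime factors divide $c$ (so $1\in\mathcal F_c$). For an integer $c>1$ with prime factorization $c=p_1^{c_1}\cdots p_r^{c_r}$ where $p_1$ is the smallest prime factor of $c$, $K^{(j)}_c$ denotes the smallest positive integer $K$ such that $K p_1^{-K}\le (\min_{1\le i\le r} c_i)/j$. *)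

theory Defs
  imports Complex_Main "HOL-Computational_Algebra.Primes"
begin

(* Natural numbers are positive here; n = 0 must be excluded explicitly, since 0 ^ j dvd a ^ 0 - b ^ 0
   holds for j > 0. *)
definition divR :: "nat \<Rightarrow> int \<Rightarrow> int \<Rightarrow> nat set" where
  "divR j a b = {n. n > 0 \<and> int n ^ j dvd a ^ n - b ^ n}"

definition smoothF :: "nat \<Rightarrow> nat set" where
  "smoothF c = {n. n > 0 \<and> (\<forall>p. prime p \<longrightarrow> p dvd n \<longrightarrow> p dvd c)}"

(* Meaningful for c > 1 and j \<ge> 1: then the minima are over nonempty finite sets, and a suitable K
   exists because K / p ^ K tends to 0. *)
definition threshK :: "nat \<Rightarrow> nat \<Rightarrow> nat" where
  "threshK j c = (LEAST K. K > 0 \<and>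
     real K / real (Min (prime_factors c)) ^ K
       \<le> real (MIN p\<in>prime_factors c. multiplicity p c) / real j)"

end

theory Submission
  imports Defs
begin

text \<open>Take for \<open>R\<close> the elements of the right-hand set outside \<open>divR j a b\<close>. Since
  \<open>a ^ n - b ^ n = g ^ n * (a1 ^ n - b1 ^ n)\<close> and \<open>n1\<close> is coprime to \<open>g\<close>, the number \<open>n = G * n1\<close>
  can only fail to lie in \<open>divR j a b\<close> when \<open>G ^ j\<close> does not divide \<open>g ^ (G * n1)\<close>, that is when
  \<open>j * v\<^sub>p(G) > G * n1 * v\<^sub>p(g)\<close> for some prime \<open>p\<close>.
  The bound \<open>n1 < j / 2\<close> then follows from \<open>G \<ge> 2 ^ v\<^sub>p(G) \<ge> 2 * v\<^sub>p(G)\<close>, and the bound on the number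
  \<open>L\<close> of prime factors of \<open>G\<close> from \<open>G \<ge> p1 ^ L\<close> and the monotonicity of \<open>L / p1 ^ L\<close>.\<close>

section \<open>Elementary inequalities on exponentials\<close>

lemma two_times_le_two_power: "2 * l \<le> 2 ^ l" if "l \<ge> 1" for l :: nat
  using that by (induction l rule: dec_induct) auto

text \<open>One step from \<open>n\<close> to \<open>Suc n\<close> does not increase the quotient
  because \<open>n + 1 \<le> 2 * n \<le> p * n\<close>. The start \<open>m \<ge> 1\<close> matters,
  since the quotient at 0 is 0.\<close>

lemma divide_power_antimono:
  fixes p m n :: nat
  assumes "p \<ge> 2" "1 \<le> m" "m \<le> n"
  shows "real n / real p ^ n \<le> real m / real p ^ m"
  using assms(3)
proof (induction n rule: dec_induct)
  case base
  show ?case by simp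
next
  case (step n)
  have "Suc n \<le> 2 * n" using assms(2) step.hyps by simp
  also have "\<dots> \<le> p * n" using assms(1) by simp
  finally have "real (Suc n) \<le> real p * real n"
    by (metis of_nat_le_iff of_nat_mult)
  then have "real (Suc n) / real p ^ Suc n \<le> real n / real p ^ n"
    using assms(1) by (simp add: divide_simps mult.commute)
  with step.IH show ?case by linarith
qed

section \<open>Smooth parts and coprime cofactors\<close>

text \<open>Primes common to \<open>g\<close> and \<open>n\<close> are moved from \<open>n\<close>
  into the smooth part one at a time, until the remaining cofactor is coprime to
  \<open>g\<close>.\<close>

lemma smooth_coprime_decomposition:
  fixes g n :: nat
  assumes "n > 0"
  shows "\<exists>G m. n = G * m \<and> G \<in> smoothF g \<and> coprime g m"
  using assms
proof (induction n rule: less_induct)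
  case (less n)
  show ?case
  proof (cases "coprime g n")
    case True
    have "n = 1 * n" "1 \<in> smoothF g" by (auto simp: smoothF_def)
    with True show ?thesis by blast
  next
    case False
    then obtain p where p: "prime p" "p dvd g" "p dvd n"
      by (metis coprime_iff_gcd_eq_1 gcd_greatest_iff prime_factor_nat)
    then obtain k where k: "n = p * k" by blast
    have "k > 0" "k < n" using less.prems k prime_gt_1_nat[OF p(1)] by auto
    from less.IH[OF this(2,1)] obtain G m where
      Gm: "k = G * m" "G \<in> smoothF g" "coprime g m" by blast
    have "p * G \<in> smoothF g"
      using Gm(2) p prime_gt_0_nat[OF p(1)]
      by (auto simp: smoothF_def prime_dvd_mult_iff primes_dvd_imp_eq)
    moreover have "n = (p * G) * m" using k Gm(1) by simp
    ultimately show ?thesis using Gm(3) by blast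
  qed
qed

lemma smoothF_coprime:
  assumes "G \<in> smoothF g" "coprime g m"
  shows "coprime G m"
proof (rule ccontr)
  assume "\<not> coprime G m"
  then obtain p where p: "prime p" "p dvd G" "p dvd m"
    by (metis coprime_iff_gcd_eq_1 gcd_greatest_iff prime_factor_nat)
  then have "p dvd g" using assms(1) by (auto simp: smoothF_def)
  with p assms(2) show False
    by (metis coprime_common_divisor not_prime_unit)
qed

text \<open>Indexing by the primes of \<open>g\<close> instead of those of \<open>G\<close> only
  adds factors with exponent 0, as every prime of \<open>G\<close> divides \<open>g\<close>.\<close>

lemma smoothF_eq_prod:
  assumes "G \<in> smoothF g" "g > 0"
  shows "G = (\<Prod>q\<in>prime_factors g. q ^ multiplicity q G)"
proof -
  have G: "G > 0" using assms(1) by (simp add: smoothF_def)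
  have "G = (\<Prod>q\<in>prime_factors G. q ^ multiplicity q G)"
    using prime_factorization_nat[OF G] .
  also have "\<dots> = (\<Prod>q\<in>prime_factors g. q ^ multiplicity q G)"
  proof (rule prod.mono_neutral_left)
    show "prime_factors G \<subseteq> prime_factors g"
      using assms by (auto simp: smoothF_def prime_factors_dvd)
    show "\<forall>q\<in>prime_factors g - prime_factors G. q ^ multiplicity q G = 1"
    proof
      fix q assume q: "q \<in> prime_factors g - prime_factors G"
      then have "prime q" by blast
      with q G have "\<not> q dvd G" by (simp add: prime_factors_dvd)
      then show "q ^ multiplicity q G = 1" by (simp add: not_dvd_imp_multiplicity_0)
    qed
  qed simp
  finally show ?thesis .
qed

section \<open>Divisibility of powers through multiplicities\<close>

lemma power_dvd_power_if_multiplicity: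
  fixes G g :: nat
  assumes "G > 0" "g > 0"
    and "\<And>p. prime p \<Longrightarrow> j * multiplicity p G \<le> N * multiplicity p g"
  shows "G ^ j dvd g ^ N"
  using assms
  by (intro multiplicity_le_imp_dvd)
     (auto simp: prime_elem_multiplicity_power_distrib)

text \<open>With \<open>l\<close> the multiplicity of \<open>p\<close> in \<open>G\<close>, the
  chain \<open>2 * l \<le> 2 ^ l \<le> p ^ l \<le> G\<close> gives
  \<open>j * l \<le> 2 * n * l \<le> G * n\<close>. The contrapositive bounds the cofactor of an
  exceptional number.\<close>

lemma smooth_power_dvd_if_large_cofactor:
  assumes "G \<in> smoothF g" "g > 0" "j \<le> 2 * n"
  shows "G ^ j dvd g ^ (G * n)"
proof (rule power_dvd_power_if_multiplicity)
  show G: "G > 0" using assms(1) by (simp add: smoothF_def)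
  fix p :: nat assume p: "prime p"
  define l where "l = multiplicity p G"
  show "j * multiplicity p G \<le> G * n * multiplicity p g"
  proof (cases "l = 0")
    case False
    then have "p dvd G" unfolding l_def by (metis not_dvd_imp_multiplicity_0)
    then have "p dvd g" using assms(1) p by (auto simp: smoothF_def)
    then have vg: "multiplicity p g \<ge> 1"
      using p assms(2) by (metis multiplicity_eq_zero_iff not_prime_unit less_one not_le
        neq0_conv)
    have "2 * l \<le> 2 ^ l" using False two_times_le_two_power by simp
    also have "\<dots> \<le> p ^ l" using prime_ge_2_nat[OF p] by (intro power_mono) auto
    also have "\<dots> \<le> G"
      using G by (intro dvd_imp_le) (auto simp: l_def multiplicity_dvd)
    finally have "2 * l \<le> G" .
    have "j * l \<le> 2 * n * l" using assms(3) by simp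
    also have "\<dots> \<le> G * n" using mult_le_mono1[OF \<open>2 * l \<le> G\<close>, of n] by (simp add: ac_simps)
    also have "\<dots> \<le> G * n * multiplicity p g" using vg by simp
    finally show ?thesis by (simp add: l_def)
  qed (simp add: l_def)
qed (use assms in auto)

section \<open>The threshold and the number of prime factors of the smooth part\<close>

context
  fixes g j n :: nat
  assumes g: "g > 1" and j: "j \<ge> 1" and n: "n \<ge> 1"
begin

lemma prime_factors_power_cofactor: "prime_factors (g ^ n) = prime_factors g"
  proof -
  have "g ^ n \<noteq> 0" "g \<noteq> 0" "n > 0" using g n by simp_all
  then show ?thesis
    unfolding prime_factors_dvd[OF \<open>g ^ n \<noteq> 0\<close>] prime_factors_dvd[OF \<open>g \<noteq> 0\<close>]
    by (metis prime_dvd_power_iff)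
qed

lemma Min_prime_factors_ge_2: "Min (prime_factors g) \<ge> 2"
  and prime_factors_ne: "prime_factors g \<noteq> {}"
proof -
  show ne: "prime_factors g \<noteq> {}"
    using g prime_factor_nat[of g] by (auto simp: prime_factors_dvd)
  then have "Min (prime_factors g) \<in> prime_factors g" by simp
  then show "Min (prime_factors g) \<ge> 2" by (rule prime_ge_2_nat[OF in_prime_factors_imp_prime])
qed

lemma Min_multiplicity_ge_1: "(MIN p\<in>prime_factors (g ^ n). multiplicity p (g ^ n)) \<ge> 1"
proof -
  have "multiplicity p (g ^ n) \<ge> 1" if "p \<in> prime_factors g" for p
  proof -
    have "p \<in> prime_factors (g ^ n)" using that prime_factors_power_cofactor by simp
    then have "multiplicity p (g ^ n) > 0" unfolding prime_factors_multiplicity by blast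
    then show ?thesis by simp
  qed
  then show ?thesis
    using prime_factors_ne by (simp add: prime_factors_power_cofactor)
qed

text \<open>An explicit admissible threshold, which makes \<open>threshK\<close> meaningful and bounds it
  uniformly in \<open>n\<close>.\<close>
lemma threshold_admissible:
  "real (2 * j) / real (Min (prime_factors (g ^ n))) ^ (2 * j)
    \<le> real (MIN p\<in>prime_factors (g ^ n). multiplicity p (g ^ n)) / real j"
proof -
  let ?p = "Min (prime_factors g)"
  \<comment> \<open>The minimal multiplicity is at least 1, so it suffices that
    \<open>2 * j * j\<close> is at most \<open>?p ^ (2 * j)\<close>; this comes from multiplying
    \<open>2 * j \<le> 2 ^ j\<close> and \<open>j \<le> 2 ^ j\<close>.\<close>
  have "2 * j * j \<le> 2 ^ j * 2 ^ j"
    using two_times_le_two_power[OF j] by (intro mult_le_mono) auto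
  also have "\<dots> = 2 ^ (2 * j)" by (simp add: mult_2 power_add)
  also have "\<dots> \<le> ?p ^ (2 * j)" using Min_prime_factors_ge_2 by (intro power_mono) auto
  finally have "real (2 * j * j) \<le> real (?p ^ (2 * j))" by (simp only: of_nat_le_iff)
  then have "real (2 * j) / real ?p ^ (2 * j) \<le> 1 / real j"
    using j Min_prime_factors_ge_2 by (simp add: divide_simps)
  also have "\<dots> \<le> real (MIN p\<in>prime_factors (g ^ n). multiplicity p (g ^ n)) / real j"
    using Min_multiplicity_ge_1 by (intro divide_right_mono) auto
  finally show ?thesis by (simp add: prime_factors_power_cofactor)
qed

text \<open>Independence of \<open>n\<close> is what counts here: one bound serves all cofactors at
  once when the exceptional set is shown to be finite.\<close>

lemma threshK_le: "threshK j (g ^ n) \<le> 2 * j"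
  unfolding threshK_def using threshold_admissible j by (intro Least_le) auto

text \<open>The least element satisfies its defining property because \<open>2 * j\<close> is a
  witness. The primes are rewritten to those of \<open>g\<close>, while the multiplicities remain
  those of \<open>g ^ n\<close>.\<close>

lemma threshK_props:
  shows "threshK j (g ^ n) > 0"
    and "real (threshK j (g ^ n)) / real (Min (prime_factors g)) ^ threshK j (g ^ n)
      \<le> real (MIN p\<in>prime_factors g. multiplicity p (g ^ n)) / real j"
proof -
  have "threshK j (g ^ n) > 0 \<and>
     real (threshK j (g ^ n)) / real (Min (prime_factors (g ^ n))) ^ threshK j (g ^ n)
       \<le> real (MIN p\<in>prime_factors (g ^ n). multiplicity p (g ^ n)) / real j"
    unfolding threshK_def
    by (rule LeastI[of _ "2 * j"]) (use threshold_admissible j in auto)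
  then show "threshK j (g ^ n) > 0"
    and "real (threshK j (g ^ n)) / real (Min (prime_factors g)) ^ threshK j (g ^ n)
      \<le> real (MIN p\<in>prime_factors g. multiplicity p (g ^ n)) / real j"
    by (simp_all add: prime_factors_power_cofactor)
qed

lemma smooth_power_dvd_if_many_factors:
  assumes G: "G \<in> smoothF g"
    and L: "(\<Sum>q\<in>prime_factors g. multiplicity q G) \<ge> threshK j (g ^ n)"
  shows "G ^ j dvd g ^ (G * n)"
proof (rule power_dvd_power_if_multiplicity)
  show G0: "G > 0" using G by (simp add: smoothF_def)
  let ?L = "\<Sum>q\<in>prime_factors g. multiplicity q G"
  let ?p = "Min (prime_factors g)"
  fix p :: nat assume p: "prime p"
  show "j * multiplicity p G \<le> G * n * multiplicity p g"
  proof (cases "p dvd G")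
    case True
    with G p g have pg: "p \<in> prime_factors g" by (auto simp: smoothF_def prime_factors_dvd)
    \<comment> \<open>Replacing each prime factor of \<open>G\<close> by the smallest prime of
      \<open>g\<close> can only decrease the product.\<close>
    have "?p ^ ?L = (\<Prod>q\<in>prime_factors g. ?p ^ multiplicity q G)" by (rule power_sum)
    also have "\<dots> \<le> (\<Prod>q\<in>prime_factors g. q ^ multiplicity q G)"
      by (intro prod_mono conjI power_mono) auto
    also have "\<dots> = G" using smoothF_eq_prod[OF G] g by simp
    finally have pL: "?p ^ ?L \<le> G" .
    \<comment> \<open>As \<open>?L\<close> is at least the threshold, monotonicity carries the
      defining inequality of the threshold over to \<open>?L\<close>.\<close>
    have "real ?L / real ?p ^ ?L \<le> real (threshK j (g ^ n)) / real ?p ^ threshK j (g ^ n)"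
      using threshK_props(1) L Min_prime_factors_ge_2 by (intro divide_power_antimono) auto
    also have "\<dots> \<le> real (MIN p\<in>prime_factors g. multiplicity p (g ^ n)) / real j"
      by (rule threshK_props(2))
    also have "\<dots> \<le> real (multiplicity p (g ^ n)) / real j"
      using pg by (intro divide_right_mono) auto
    also have "multiplicity p (g ^ n) = n * multiplicity p g"
      using p g by (simp add: prime_elem_multiplicity_power_distrib)
    finally have "real (j * ?L) \<le> real (?p ^ ?L * (n * multiplicity p g))"
      using j Min_prime_factors_ge_2 by (simp add: divide_simps ac_simps)
    then have "j * ?L \<le> ?p ^ ?L * (n * multiplicity p g)" by (simp only: of_nat_le_iff)
    also have "\<dots> \<le> G * (n * multiplicity p g)" using pL by (rule mult_le_mono1)
    finally have "j * ?L \<le> G * n * multiplicity p g" by (simp add: ac_simps)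
    \<comment> \<open>The inequality was proved for the total count \<open>?L\<close>, which
      dominates each single exponent.\<close>
    moreover have "multiplicity p G \<le> ?L" using pg by (intro member_le_sum) auto
    ultimately show ?thesis by (meson le_trans mult_le_mono2)
  qed (simp add: not_dvd_imp_multiplicity_0)
qed (use g in simp)

end

section \<open>Size of smooth numbers and the exceptional set\<close>

text \<open>Each prime factor of \<open>G\<close> is at most \<open>g\<close>, and there are at most
  \<open>M\<close> of them counted with multiplicity.\<close>

lemma smoothF_le_power:
  assumes "G \<in> smoothF g" "g > 1" "(\<Sum>q\<in>prime_factors g. multiplicity q G) \<le> M"
  shows "G \<le> g ^ M"
proof -
  have "G = (\<Prod>q\<in>prime_factors g. q ^ multiplicity q G)"
    using smoothF_eq_prod assms(1,2) by simp
  also have "\<dots> \<le> (\<Prod>q\<in>prime_factors g. g ^ multiplicity q G)"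
    using assms(2) by (intro prod_mono conjI power_mono) (auto simp: prime_factors_dvd dvd_imp_le)
  also have "\<dots> = g ^ (\<Sum>q\<in>prime_factors g. multiplicity q G)" by (simp add: power_sum)
  also have "\<dots> \<le> g ^ M" using assms(2,3) by (intro power_increasing) auto
  finally show ?thesis .
qed

theorem theorem4:
  fixes a b a1 b1 :: int and g j :: nat
  assumes "j \<ge> 1"
    and "int g = gcd a b"
    and "g > 1"
    and "a = a1 * int g"
    and "b = b1 * int g"
  shows "\<exists>R :: nat set. finite R \<and> (\<forall>n\<in>R. n > 0) \<and>
    divR j a b =
      {n. \<exists>G n1. n = G * n1 \<and> G \<in> smoothF g \<and> n1 \<in> divR j (a1 ^ G) (b1 ^ G) \<and> coprime g n1} - R \<and>
    (\<forall>n\<in>R. \<exists>G n1. \<exists>l :: nat \<Rightarrow> nat.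
      n = G * n1 \<and> G \<in> smoothF g \<and> coprime n1 g \<and>
      1 \<le> n1 \<and> real n1 < real j / 2 \<and>
      G = (\<Prod>q\<in>prime_factors g. q ^ l q) \<and>
      (\<Sum>q\<in>prime_factors g. l q) < threshK j (g ^ n1))"
proof -
  define S where "S = {n. \<exists>G n1. n = G * n1 \<and> G \<in> smoothF g \<and>
    n1 \<in> divR j (a1 ^ G) (b1 ^ G) \<and> coprime g n1}"
  define R where "R = S - divR j a b"
  have diff: "a ^ n - b ^ n = int g ^ n * (a1 ^ n - b1 ^ n)" for n
    by (simp add: assms(4,5) power_mult_distrib algebra_simps)

  \<comment> \<open>Since \<open>R\<close> is the full difference, the required equation
    \<open>divR j a b = S - R\<close> reduces to this inclusion.\<close>
  have sub: "divR j a b \<subseteq> S"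
  proof
    fix n assume "n \<in> divR j a b"
    then have n: "n > 0" "int n ^ j dvd int g ^ n * (a1 ^ n - b1 ^ n)"
      by (auto simp: divR_def diff)
    from smooth_coprime_decomposition[OF n(1), of g] obtain G m where
      Gm: "n = G * m" "G \<in> smoothF g" "coprime g m" by blast
    have "int m ^ j dvd int n ^ j" using Gm(1) by (intro dvd_power_same) simp
    with n(2) have "int m ^ j dvd int g ^ n * (a1 ^ n - b1 ^ n)" by (rule dvd_trans[rotated])
    \<comment> \<open>Coprimality strips the factor \<open>g ^ n\<close>; reading
      \<open>a1 ^ n\<close> as \<open>(a1 ^ G) ^ m\<close> then gives membership for the cofactor
      \<open>m\<close>.\<close>
    moreover have "coprime (int m ^ j) (int g ^ n)"
      using Gm(3) by (simp add: coprime_commute)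
    ultimately have "int m ^ j dvd a1 ^ n - b1 ^ n"
      by (simp add: coprime_dvd_mult_right_iff)
    then have "m \<in> divR j (a1 ^ G) (b1 ^ G)"
      using n(1) Gm(1) by (auto simp: divR_def power_mult)
    with Gm show "n \<in> S" by (auto simp: S_def)
  qed

  have exc: "\<exists>G m. n = G * m \<and> G \<in> smoothF g \<and> coprime m g \<and> 1 \<le> m \<and> 2 * m < j \<and>
      (\<Sum>q\<in>prime_factors g. multiplicity q G) < threshK j (g ^ m)" if "n \<in> R" for n
  proof -
    from that obtain G m where Gm: "n = G * m" "G \<in> smoothF g"
      "m \<in> divR j (a1 ^ G) (b1 ^ G)" "coprime g m" and notin: "n \<notin> divR j a b"
      by (auto simp: R_def S_def)
    have m: "m \<ge> 1" and mdvd: "int m ^ j dvd a1 ^ n - b1 ^ n"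
      using Gm(1,3) by (auto simp: divR_def power_mult)
    have G: "G > 0" using Gm(2) by (simp add: smoothF_def)
    \<comment> \<open>As \<open>m ^ j\<close> divides the second factor
      \<open>a1 ^ n - b1 ^ n\<close>, divisibility of \<open>g ^ n\<close> by \<open>G ^ j\<close>
      would put \<open>n\<close> into \<open>divR j a b\<close>.\<close>
    have ndvd: "\<not> G ^ j dvd g ^ (G * m)"
    proof
      assume "G ^ j dvd g ^ (G * m)"
      then have "int G ^ j dvd int g ^ n"
        unfolding Gm(1) by (metis of_nat_dvd_iff of_nat_power)
      from mult_dvd_mono[OF this mdvd] have "int n ^ j dvd a ^ n - b ^ n"
        by (simp add: diff Gm(1) power_mult_distrib)
      with notin m G Gm(1) show False by (simp add: divR_def)
    qed
    have "2 * m < j"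
      using ndvd smooth_power_dvd_if_large_cofactor[OF Gm(2), of j m] assms(3) by force
    moreover have "(\<Sum>q\<in>prime_factors g. multiplicity q G) < threshK j (g ^ m)"
      using ndvd smooth_power_dvd_if_many_factors[OF assms(3,1) m Gm(2)] by force
    moreover have "coprime m g" using Gm(4) by (simp add: coprime_commute)
    ultimately show ?thesis using Gm(1,2) m by blast
  qed

  \<comment> \<open>The smooth part has at most \<open>2 * j\<close> prime factors, hence is at most
    \<open>g ^ (2 * j)\<close>, and the cofactor is below \<open>j\<close>.\<close>
  have "R \<subseteq> {..g ^ (2 * j) * j}"
  proof
    fix n assume "n \<in> R"
    from exc[OF this] obtain G m where Gm: "n = G * m" "G \<in> smoothF g" "1 \<le> m" "2 * m < j"
      "(\<Sum>q\<in>prime_factors g. multiplicity q G) < threshK j (g ^ m)" by blast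
    have "(\<Sum>q\<in>prime_factors g. multiplicity q G) \<le> 2 * j"
      using threshK_le[OF assms(3,1) Gm(3)] Gm(5) by simp
    then have "G \<le> g ^ (2 * j)" using smoothF_le_power[OF Gm(2) assms(3)] by blast
    then show "n \<in> {..g ^ (2 * j) * j}" using Gm(1,4) by (simp add: mult_le_mono)
  qed
  then have "finite R" by (rule finite_subset) simp
  moreover have "n > 0" if "n \<in> R" for n
    using that by (auto simp: R_def S_def smoothF_def divR_def)
  moreover have "divR j a b = S - R" using sub by (auto simp: R_def)
  moreover have "\<exists>G n1. \<exists>l :: nat \<Rightarrow> nat.
      n = G * n1 \<and> G \<in> smoothF g \<and> coprime n1 g \<and>
      1 \<le> n1 \<and> real n1 < real j / 2 \<and>
      G = (\<Prod>q\<in>prime_factors g. q ^ l q) \<and>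
      (\<Sum>q\<in>prime_factors g. l q) < threshK j (g ^ n1)" if "n \<in> R" for n
  proof -
    from exc[OF that] obtain G m where Gm: "n = G * m" "G \<in> smoothF g" "coprime m g" "1 \<le> m"
      "2 * m < j" "(\<Sum>q\<in>prime_factors g. multiplicity q G) < threshK j (g ^ m)" by blast
    have "G = (\<Prod>q\<in>prime_factors g. q ^ multiplicity q G)"
      using smoothF_eq_prod[OF Gm(2)] assms(3) by simp
    moreover have "real m < real j / 2" using Gm(5) by linarith
    ultimately show ?thesis using Gm
      by (intro exI[of _ G] exI[of _ m] exI[of _ "\<lambda>q. multiplicity q G"] conjI)
  qed
  ultimately show ?thesis
    unfolding S_def by (intro exI[of _ R] conjI ballI)
qed

end
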